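(* Let $p$ be a prime. (a) If $A$ is any valid multiset contained in $\mathbb{Z}_p^2$ with $|A| = p$, then $\#\Sigma A \ge 2p$. (b) Suppose that $p\ge 5$. If $A$ is any valid multiset contained in $\mathbb{Z}_p^2$ with $|A| = p+1$, then $\#\Sigma A \ge 3p$.
   Context: $\mathbb{Z}_p$ is the cyclic group of order $p$, and $\mathbb{Z}_p^2=\mathbb{Z}_p\oplus\mathbb{Z}_p$ with identity $\mathbf 0=(0,0)$. Multisets are finite. For a multiset $S$, $|S|$ is the total number of elements of $S$ counted with multiplicity, and $\#S$ is the number of distinct elements of $S$. If $A$ is a multiset in an abelian group $G$ in which $x$ occurs with multiplicity $m_x$, its sumset is the set $\Sigma A=\{\sum_{x\in G}\delta_x x : 0\le\delta_x\le m_x,\ \delta_x\in\mathbb{Z}\}$ of all sums of submultisets of $A$ (including the empty sum). A multiset $A$ contained in $\mathbb{Z}_p^2$ is called valid if $\mathbf 0\notin A$ and every subgroup of $\mathbb{Z}_p^2$ of order $p$ contains fewer than $p$ points of $A$, counting multiplicity. *)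

theory Defs
  imports "HOL-Algebra.Elementary_Groups" "HOL-Algebra.FiniteProduct" "HOL-Library.Multiset"
    "HOL-Computational_Algebra.Primes"
begin

text \<open>Groups from HOL-Algebra are written multiplicatively, whatever the operation: for
  \<open>integer_mod_group p\<close> (carrier \<open>{0..<p}\<close> for \<open>p > 0\<close>) the product is addition modulo \<open>p\<close>, the
  unit is \<open>0\<close>, and \<open>x [^] n\<close> is the multiple \<open>n x\<close>.\<close>

definition Zp2 :: "nat \<Rightarrow> (int \<times> int) monoid" where
  "Zp2 p = integer_mod_group p \<times>\<times> integer_mod_group p"

text \<open>The terms with \<open>x \<notin># A\<close> have \<open>\<delta> x = 0\<close>, so the sum over the whole group is taken over the
  support of \<open>A\<close>; over an infinite carrier \<open>finprod\<close> would return its default value.\<close>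

definition sumset :: "('a, 'b) monoid_scheme \<Rightarrow> 'a multiset \<Rightarrow> 'a set" where
  "sumset G A =
    {(\<Otimes>\<^bsub>G\<^esub>x\<in>set_mset A. x [^]\<^bsub>G\<^esub> \<delta> x) | \<delta> :: 'a \<Rightarrow> nat. \<forall>x. \<delta> x \<le> count A x}"

definition valid :: "nat \<Rightarrow> (int \<times> int) multiset \<Rightarrow> bool" where
  "valid p A \<longleftrightarrow> \<one>\<^bsub>Zp2 p\<^esub> \<notin># A \<and>
    (\<forall>H. subgroup H (Zp2 p) \<and> card H = p \<longrightarrow> size {#x \<in># A. x \<in> H#} < p)"

end

theory Submission
  imports Defs "HOL-Algebra.Multiplicative_Group"
begin

text \<open>
  In a group of prime order, every further nonidentity element enlarges a sumset until it is the
  whole group, so \<open>n\<close> such elements have at least \<open>min p (n + 1)\<close> subset sums. This is used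
  twice. Let \<open>L\<close> be the line spanned by some \<open>a \<in># A\<close> and let \<open>m\<close> count the elements of \<open>A\<close> on
  \<open>L\<close>, so \<open>1 \<le> m < p\<close>. The elements on \<open>L\<close> have at least \<open>m + 1\<close> subset sums, and those off \<open>L\<close>,
  read modulo \<open>L\<close>, have sums in at least \<open>min p (|A| - m + 1)\<close> cosets; each of these cosets contains
  a translate of the sumset of the part on \<open>L\<close> (\<open>card_sumset_subgroup_cosets\<close>). For \<open>|A| = p\<close>
  the product \<open>(m + 1) (p - m + 1)\<close> exceeds \<open>2 p\<close> by \<open>(m - 1) (p - m - 1)\<close>. For \<open>|A| = p + 1\<close> and
  \<open>m \<ge> 2\<close> the product \<open>(m + 1) (p - m + 2)\<close> exceeds \<open>3 p\<close> by \<open>(m - 2) (p - m - 1)\<close>.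

  There remains \<open>|A| = p + 1\<close> and \<open>m = 1\<close>. Then \<open>B = A - {#a#}\<close> has \<open>p\<close> elements, all off \<open>L\<close>, so its
  sumset \<open>S\<close> meets all \<open>p\<close> cosets of \<open>L\<close>, and \<open>|S| \<ge> 2 p\<close> by the first part. Adjoining \<open>a\<close>
  replaces \<open>S\<close> by the union of \<open>S\<close> and its translate by \<open>a\<close>, which adds at least one point in every
  coset that \<open>S\<close> does not fill. If no coset is filled, \<open>p\<close> points are gained and \<open>3 p\<close> is reached.
  If two are filled, these contribute \<open>2 p\<close> and every other coset contributes at least two,
  which makes \<open>4 p - 4 \<ge> 3 p\<close>.
  If exactly one is filled, this count is short by two, and symmetry helps: \<open>S\<close> is invariant under
  \<open>x \<mapsto> \<sigma> - x\<close>, where \<open>\<sigma>\<close> is the sum of \<open>B\<close>. As \<open>p\<close> is odd, this reflection fixes only one coset,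
  which has to be the filled one. Since \<open>|S| \<ge> 2 p\<close>, some other coset contains at least two points of \<open>S\<close>,
  and so does its distinct mirror image; after adjoining \<open>a\<close> both contain at least three, so the total is
  at least \<open>p + 3 + 3 + 2 (p - 3) = 3 p\<close> (\<open>card_sumset_add_transversal\<close>).
\<close>

section \<open>Sumsets in abelian groups\<close>

context comm_group
begin

lemma sumset_eq_finprod_superset:
  assumes "finite V" "set_mset A \<subseteq> V" "V \<subseteq> carrier G"
  shows "sumset G A = {(\<Otimes>x\<in>V. x [^] \<delta> x) | \<delta> :: 'a \<Rightarrow> nat. \<forall>x. \<delta> x \<le> count A x}"
proof -
  have "(\<Otimes>x\<in>set_mset A. x [^] \<delta> x) = (\<Otimes>x\<in>V. x [^] \<delta> x)"
    if "\<forall>x. \<delta> x \<le> count A x" for \<delta> :: "'a \<Rightarrow> nat"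
  proof (rule finprod_mono_neutral_cong_left)
    fix i assume "i \<in> V - set_mset A"
    then have "count A i = 0" by (simp add: not_in_iff)
    then show "i [^] \<delta> i = \<one>" using that by (metis le_zero_eq nat_pow_0)
  qed (use assms in auto)
  then show ?thesis unfolding sumset_def by (intro Collect_cong) metis
qed

lemma sumset_empty [simp]: "sumset G {#} = {\<one>}"
  by (auto simp: sumset_def)

text \<open>An additional copy of \<open>a\<close> is either not used or used once. All later facts about sumsets come
  from this recursion, by induction on the multiset.\<close>

lemma sumset_add_mset:
  assumes "a \<in> carrier G" "set_mset A \<subseteq> carrier G"
  shows "sumset G (add_mset a A) = sumset G A \<union> (\<otimes>) a ` sumset G A"
proof -
  define V where "V = set_mset (add_mset a A)"
  define f where "f = (\<lambda>\<delta> :: 'a \<Rightarrow> nat. \<Otimes>x\<in>V. x [^] \<delta> x)"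
  have V: "finite V" "V \<subseteq> carrier G" "a \<in> V" "a \<in> carrier G"
    using assms by (auto simp: V_def)
  have split_V: "f \<delta> = a [^] \<delta> a \<otimes> (\<Otimes>x\<in>V - {a}. x [^] \<delta> x)" for \<delta>
  proof -
    have "f \<delta> = (\<Otimes>x\<in>insert a (V - {a}). x [^] \<delta> x)"
      using V by (simp add: f_def insert_absorb)
    also have "\<dots> = a [^] \<delta> a \<otimes> (\<Otimes>x\<in>V - {a}. x [^] \<delta> x)"
      using V by (subst finprod_insert) auto
    finally show ?thesis .
  qed
  have f_upd: "f (\<delta>(a := Suc (\<delta> a))) = a \<otimes> f \<delta>" for \<delta>
  proof -
    have "(\<Otimes>x\<in>V - {a}. x [^] (\<delta>(a := Suc (\<delta> a))) x) = (\<Otimes>x\<in>V - {a}. x [^] \<delta> x)"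
      using V by (intro finprod_cong') auto
    moreover have "(\<Otimes>x\<in>V - {a}. x [^] \<delta> x) \<in> carrier G"
      using V by (intro finprod_closed) auto
    ultimately show ?thesis
      using V unfolding split_V by (simp add: m_assoc m_lcomm)
  qed
  have A: "sumset G A = {f \<delta> | \<delta>. \<forall>x. \<delta> x \<le> count A x}"
    unfolding f_def by (rule sumset_eq_finprod_superset) (use V in \<open>auto simp: V_def\<close>)
  have aA: "sumset G (add_mset a A) = {f \<delta> | \<delta>. \<forall>x. \<delta> x \<le> count (add_mset a A) x}"
    unfolding f_def by (rule sumset_eq_finprod_superset) (use V in \<open>auto simp: V_def\<close>)
  show ?thesis
  proof (intro equalityI subsetI)
    fix y assume "y \<in> sumset G (add_mset a A)"
    then obtain \<delta> where \<delta>: "y = f \<delta>" "\<forall>x. \<delta> x \<le> count (add_mset a A) x"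
      unfolding aA by blast
    show "y \<in> sumset G A \<union> (\<otimes>) a ` sumset G A"
    proof (cases "\<delta> a \<le> count A a")
      case True
      then have "\<forall>x. \<delta> x \<le> count A x" using \<delta>(2) by (auto split: if_splits)
      then show ?thesis using \<delta>(1) unfolding A by blast
    next
      case False
      define \<delta>' where "\<delta>' = \<delta>(a := \<delta> a - 1)"
      have "\<delta> = \<delta>'(a := Suc (\<delta>' a))" using False by (auto simp: \<delta>'_def)
      then have "y = a \<otimes> f \<delta>'" using f_upd \<delta>(1) by metis
      moreover have "\<forall>x. \<delta>' x \<le> count A x"
        using \<delta>(2) by (auto simp: \<delta>'_def le_diff_conv split: if_splits)
      ultimately show ?thesis unfolding A by blast
    qed
  next
    fix y assume "y \<in> sumset G A \<union> (\<otimes>) a ` sumset G A"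
    then consider \<delta> where "y = f \<delta>" "\<forall>x. \<delta> x \<le> count A x"
      | \<delta> where "y = a \<otimes> f \<delta>" "\<forall>x. \<delta> x \<le> count A x"
      unfolding A by blast
    then show "y \<in> sumset G (add_mset a A)"
    proof cases
      case 1
      then have "\<forall>x. \<delta> x \<le> count (add_mset a A) x" by (simp add: le_SucI)
      with 1 show ?thesis unfolding aA by blast
    next
      case (2 \<delta>)
      have "\<forall>x. (\<delta>(a := Suc (\<delta> a))) x \<le> count (add_mset a A) x" using 2(2) by simp
      with 2(1) show ?thesis unfolding aA f_upd[symmetric] by blast
    qed
  qed
qed

lemma sumset_closed: "set_mset A \<subseteq> carrier G \<Longrightarrow> sumset G A \<subseteq> carrier G"
  by (induction A) (auto simp: sumset_add_mset)

lemma finite_sumset: "set_mset A \<subseteq> carrier G \<Longrightarrow> finite (sumset G A)"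
  by (induction A) (auto simp: sumset_add_mset)

lemma one_in_sumset: "set_mset A \<subseteq> carrier G \<Longrightarrow> \<one> \<in> sumset G A"
  by (induction A) (auto simp: sumset_add_mset)

lemma sumset_hom:
  assumes "comm_group K" "h \<in> hom G K" "set_mset A \<subseteq> carrier G"
  shows "h ` sumset G A = sumset K (image_mset h A)"
proof -
  interpret K: comm_group K by fact
  interpret h: group_hom G K h using assms(2) by unfold_locales
  show ?thesis using assms(3)
  proof (induction A)
    case (add a A)
    then have "a \<in> carrier G" "sumset G A \<subseteq> carrier G" "h ` set_mset A \<subseteq> carrier K"
      using sumset_closed by auto
    then have "h ` (\<otimes>) a ` sumset G A = (\<otimes>\<^bsub>K\<^esub>) (h a) ` h ` sumset G A"
      unfolding image_image by (intro image_cong) auto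
    with add \<open>a \<in> carrier G\<close> \<open>h ` set_mset A \<subseteq> carrier K\<close> show ?case
      by (simp add: sumset_add_mset K.sumset_add_mset image_Un)
  qed simp
qed

lemma mult_in_sumset_union:
  assumes "set_mset A \<subseteq> carrier G" "set_mset B \<subseteq> carrier G" "x \<in> sumset G A" "y \<in> sumset G B"
  shows "x \<otimes> y \<in> sumset G (A + B)"
  using assms
proof (induction A arbitrary: x)
  case empty
  then show ?case using sumset_closed[of B] by (auto simp: subset_eq)
next
  case (add a A)
  have "z \<in> carrier G" if "z \<in> sumset G A" for z
    using that add.prems(1) sumset_closed by auto
  moreover have "y \<in> carrier G" using add.prems sumset_closed by blast
  ultimately show ?case
    using add by (auto simp: sumset_add_mset m_assoc)
qed

text \<open>Complementary submultisets of \<open>A\<close> have sums adding up to the sum \<open>\<sigma>\<close> of \<open>A\<close>. The recursion is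
  enough to build \<open>\<sigma>\<close>: adjoining \<open>a\<close> multiplies it by \<open>a\<close> and exchanges the two parts of the new
  sumset.\<close>

lemma sumset_mirror:
  assumes "set_mset A \<subseteq> carrier G"
  obtains \<sigma> where "\<sigma> \<in> carrier G" "\<And>x. x \<in> sumset G A \<Longrightarrow> \<sigma> \<otimes> inv x \<in> sumset G A"
proof -
  have "\<exists>\<sigma>\<in>carrier G. \<forall>x\<in>sumset G A. \<sigma> \<otimes> inv x \<in> sumset G A"
    using assms
  proof (induction A)
    case (add a A)
    then obtain \<sigma> where \<sigma>: "\<sigma> \<in> carrier G" "\<And>x. x \<in> sumset G A \<Longrightarrow> \<sigma> \<otimes> inv x \<in> sumset G A"
      by auto
    have aA: "a \<in> carrier G" "set_mset A \<subseteq> carrier G" using add.prems by auto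
    have "(a \<otimes> \<sigma>) \<otimes> inv x \<in> sumset G (add_mset a A)" if "x \<in> sumset G (add_mset a A)" for x
    proof -
      consider "x \<in> sumset G A" | z where "z \<in> sumset G A" "x = a \<otimes> z"
        using \<open>x \<in> sumset G (add_mset a A)\<close> aA by (auto simp: sumset_add_mset)
      then show ?thesis
      proof cases
        case 1
        then have "x \<in> carrier G" using sumset_closed[OF aA(2)] by blast
        then have "(a \<otimes> \<sigma>) \<otimes> inv x = a \<otimes> (\<sigma> \<otimes> inv x)" using aA \<sigma> by (simp add: m_assoc)
        then show ?thesis using \<sigma>(2)[OF 1] aA by (simp add: sumset_add_mset)
      next
        case (2 z)
        then have "z \<in> carrier G" using sumset_closed[OF aA(2)] by blast
        have swap: "(u \<otimes> v) \<otimes> (w \<otimes> t) = (u \<otimes> w) \<otimes> (v \<otimes> t)"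
          if "u \<in> carrier G" "v \<in> carrier G" "w \<in> carrier G" "t \<in> carrier G" for u v w t
          using that by (simp add: m_ac)
        have "inv x = inv a \<otimes> inv z" using 2(2) aA(1) \<open>z \<in> carrier G\<close> by (simp add: inv_mult)
        then have "(a \<otimes> \<sigma>) \<otimes> inv x = (a \<otimes> inv a) \<otimes> (\<sigma> \<otimes> inv z)"
          using swap[of a \<sigma> "inv a" "inv z"] aA(1) \<sigma>(1) \<open>z \<in> carrier G\<close> by simp
        also have "\<dots> = \<sigma> \<otimes> inv z" using aA \<sigma> \<open>z \<in> carrier G\<close> by simp
        finally show ?thesis using \<sigma>(2)[OF 2(1)] aA by (simp add: sumset_add_mset)
      qed
    qed
    then show ?case using aA \<sigma>(1) by blast
  qed auto
  then show ?thesis using that by blast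
qed

text \<open>A finite set stable under translation by \<open>a\<close> is a union of cosets of the subgroup generated by
  \<open>a\<close>. Hence translation by \<open>a\<close> yields a new point as soon as \<open>S\<close> contains one element of such a
  coset but not all of it.\<close>

lemma card_less_card_Un_translate:
  assumes "finite (carrier G)" "S \<subseteq> carrier G" "a \<in> carrier G"
    and "s \<in> S" "\<not> generate G {a} #> s \<subseteq> S"
  shows "card S < card (S \<union> (\<otimes>) a ` S)"
proof (rule psubset_card_mono)
  show "finite (S \<union> (\<otimes>) a ` S)" using assms finite_subset by auto
  have "\<not> (\<otimes>) a ` S \<subseteq> S"
  proof
    assume stable: "(\<otimes>) a ` S \<subseteq> S"
    have "a [^] n \<otimes> s \<in> S" for n :: nat
    proof (induction n)
      case 0
      then show ?case using assms by auto
    next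
      case (Suc n)
      have "a [^] Suc n \<otimes> s = a \<otimes> (a [^] n \<otimes> s)"
        using assms by (simp add: m_ac subset_eq)
      then show ?case using Suc stable by auto
    qed
    moreover have "ord a \<noteq> 0" using ord_ge_1[OF assms(1,3)] by simp
    ultimately have "generate G {a} #> s \<subseteq> S"
      by (auto simp: generate_pow_nat[OF assms(3)] r_coset_def)
    with assms show False by simp
  qed
  then show "S \<subset> S \<union> (\<otimes>) a ` S" by blast
qed

text \<open>The only nonempty set stable under translation by a nonidentity element is the whole group,
  because that element generates it. So every element of \<open>A\<close> adds a point until the group is
  exhausted.\<close>

lemma card_sumset_prime_order:
  assumes "prime (order G)" "set_mset A \<subseteq> carrier G" "\<one> \<notin># A"
  shows "card (sumset G A) \<ge> min (order G) (size A + 1)"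
  using assms(2,3)
proof (induction A)
  case (add a A)
  let ?S = "sumset G A"
  have fin: "finite (carrier G)" using assms(1) by (metis not_prime_0 order_gt_0_iff_finite gr0I)
  have a: "a \<in> carrier G" "a \<noteq> \<one>" "set_mset A \<subseteq> carrier G" using add.prems by auto
  have S: "?S \<subseteq> carrier G" "finite ?S" "\<one> \<in> ?S"
    using a(3) by (simp_all add: sumset_closed finite_sumset one_in_sumset)
  have "card ?S < card (sumset G (add_mset a A))" if "?S \<noteq> carrier G"
  proof -
    have "ord a = order G"
      using ord_dvd_group_order[OF a(1)] assms(1) a ord_eq_1 by (auto simp: prime_nat_iff)
    then have "card (generate G {a}) = card (carrier G)"
      using generate_pow_card[OF a(1)] by (simp add: order_def)
    then have "generate G {a} = carrier G"
      using fin a(1) by (intro card_subset_eq generate_incl) auto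
    then have "\<not> generate G {a} #> \<one> \<subseteq> ?S" using S(1) that by (simp add: coset_mult_one)
    then show ?thesis
      using card_less_card_Un_translate[OF fin S(1) a(1) S(3)] a by (simp add: sumset_add_mset)
  qed
  moreover have "order G \<le> card (sumset G (add_mset a A))" if "?S = carrier G"
    using a that finite_sumset[of "add_mset a A"] unfolding order_def
    by (intro card_mono) (auto simp: sumset_add_mset)
  ultimately show ?case using add by fastforce
qed simp

lemma sumset_subgroup:
  assumes "subgroup L G" "set_mset B \<subseteq> L"
  shows "comm_group (G\<lparr>carrier := L\<rparr>)" "sumset (G\<lparr>carrier := L\<rparr>) B = sumset G B"
proof -
  have L: "L \<subseteq> carrier G" using assms(1) by (rule subgroup.subset)
  show comm: "comm_group (G\<lparr>carrier := L\<rparr>)"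
    using subgroup_imp_group[OF assms(1)]
    by (rule group.group_comm_groupI) (use L m_comm in auto)
  then interpret L: comm_group "G\<lparr>carrier := L\<rparr>" .
  have "id \<in> hom (G\<lparr>carrier := L\<rparr>) G" using L by (auto simp: hom_def)
  then show "sumset (G\<lparr>carrier := L\<rparr>) B = sumset G B"
    using L.sumset_hom[of G id B] comm_group_axioms assms(2) by simp
qed

lemma sumset_in_subgroup:
  assumes "subgroup L G" "set_mset B \<subseteq> L"
  shows "sumset G B \<subseteq> L"
  using comm_group.sumset_closed[OF sumset_subgroup(1)[OF assms], of B] sumset_subgroup(2)[OF assms]
    assms(2) by simp

lemma card_sumset_in_subgroup:
  assumes "subgroup L G" "prime (card L)" "set_mset B \<subseteq> L" "\<one> \<notin># B"
  shows "card (sumset G B) \<ge> min (card L) (size B + 1)"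
  using comm_group.card_sumset_prime_order[OF sumset_subgroup(1)[OF assms(1,3)], of B]
    sumset_subgroup(2)[OF assms(1,3)] assms by (simp add: order_def)

lemma card_eq_sum_cosets:
  assumes "finite (carrier G)" "subgroup L G" "S \<subseteq> carrier G"
  shows "card S = (\<Sum>X\<in>rcosets L. card (S \<inter> X))"
proof -
  have "S = (\<Union>X\<in>rcosets L. S \<inter> X)"
    using rcosets_part_G[OF assms(2)] assms(3) by blast
  moreover have "finite (rcosets L)"
    using assms rcosets_part_G finite_UnionD by metis
  moreover have "finite S" using assms finite_subset by blast
  ultimately show ?thesis
    using rcos_disjoint[OF assms(2)]
    by (subst \<open>S = _\<close>, subst card_UN_disjoint) (auto simp: pairwise_def disjnt_def)
qed

text \<open>The image of the sumset in \<open>G Mod L\<close> is the sumset of the images, which are nonidentity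
  elements because \<open>C\<close> avoids \<open>L\<close>; the quotient has prime order.\<close>

lemma card_cosets_meeting_sumset:
  assumes "subgroup L G" "prime (card (rcosets L))" "set_mset C \<subseteq> carrier G - L"
  shows "card ((#>) L ` sumset G C) \<ge> min (card (rcosets L)) (size C + 1)"
proof -
  interpret L: normal L G using assms(1) by (simp add: normal_iff_subgroup)
  interpret Q: comm_group "G Mod L" using assms(1) by (rule abelian_FactGroup)
  have "order (G Mod L) = card (rcosets L)" by (simp add: order_def FactGroup_def)
  moreover have "(#>) L ` sumset G C = sumset (G Mod L) (image_mset ((#>) L) C)"
    using sumset_hom[OF Q.comm_group_axioms L.r_coset_hom_Mod] assms(3) by blast
  moreover have "set_mset (image_mset ((#>) L) C) \<subseteq> carrier (G Mod L)"
    using assms(3) by (auto simp: FactGroup_def RCOSETS_def)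
  moreover have "\<one>\<^bsub>G Mod L\<^esub> \<notin># image_mset ((#>) L) C"
  proof
    assume "\<one>\<^bsub>G Mod L\<^esub> \<in># image_mset ((#>) L) C"
    then obtain c where "c \<in># C" "L #> c = L" by (auto simp: FactGroup_def)
    then show False using coset_join1[of L c] assms(1,3) by blast
  qed
  ultimately show ?thesis
    using Q.card_sumset_prime_order assms(2) by (metis size_image_mset)
qed

text \<open>Split \<open>A\<close> into the part \<open>B\<close> on \<open>L\<close> and the part \<open>C\<close> off \<open>L\<close>. Every coset that contains a
  sum \<open>c\<close> of \<open>C\<close> contains the whole translate of the sumset of \<open>B\<close> by \<open>c\<close>.\<close>

lemma card_sumset_subgroup_cosets:
  assumes "finite (carrier G)" "subgroup L G" "set_mset A \<subseteq> carrier G"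
    and "prime (card L)" "prime (card (rcosets L))" "\<one> \<notin># A"
  defines "m \<equiv> size {#x \<in># A. x \<in> L#}"
  shows "card (sumset G A) \<ge> min (card L) (m + 1) * min (card (rcosets L)) (size A - m + 1)"
proof -
  define B where "B = {#x \<in># A. x \<in> L#}"
  define C where "C = {#x \<in># A. x \<notin> L#}"
  have A: "A = B + C" unfolding B_def C_def by (rule multiset_partition)
  have B: "set_mset B \<subseteq> L" "\<one> \<notin># B" "set_mset B \<subseteq> carrier G" "size B = m"
    using assms(3,6) by (auto simp: B_def m_def)
  have C: "set_mset C \<subseteq> carrier G - L" "set_mset C \<subseteq> carrier G" "size C = size A - m"
  proof -
    show "set_mset C \<subseteq> carrier G - L" "set_mset C \<subseteq> carrier G" using assms(3) by (auto simp: C_def)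
    show "size C = size A - m" using arg_cong[OF A, of size] B(4) by simp
  qed
  let ?X = "(#>) L ` sumset G C"
  have X: "?X \<subseteq> rcosets L" using sumset_closed[OF C(2)] by (auto simp: RCOSETS_def)
  have finR: "finite (rcosets L)"
    using assms(1,2) rcosets_part_G finite_UnionD by metis
  have fibre: "card (sumset G B) \<le> card (sumset G A \<inter> Y)" if Y: "Y \<in> ?X" for Y
  proof -
    obtain c where c: "c \<in> sumset G C" "Y = L #> c" using Y by blast
    have cG: "c \<in> carrier G" using c sumset_closed[OF C(2)] by blast
    have BL: "sumset G B \<subseteq> L" using assms(2) B(1) by (rule sumset_in_subgroup)
    have "(\<lambda>b. b \<otimes> c) ` sumset G B \<subseteq> sumset G A \<inter> Y"
      using mult_in_sumset_union[OF B(3) C(2) _ c(1)] BL A c(2) by (auto simp: r_coset_def)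
    moreover have "inj_on (\<lambda>b. b \<otimes> c) (sumset G B)"
      using cG sumset_closed[OF B(3)] by (auto simp: inj_on_def subset_eq)
    moreover have "finite (sumset G A \<inter> Y)" using finite_sumset[OF assms(3)] by simp
    ultimately show ?thesis by (metis card_image card_mono)
  qed
  have "min (card L) (m + 1) * min (card (rcosets L)) (size A - m + 1)
      \<le> card (sumset G B) * card ?X"
    using card_sumset_in_subgroup[OF assms(2,4) B(1,2)]
      card_cosets_meeting_sumset[OF assms(2,5) C(1)] B(4) C(3) by (intro mult_le_mono) auto
  also have "\<dots> \<le> (\<Sum>Y\<in>?X. card (sumset G A \<inter> Y))"
    using sum_mono[of ?X "\<lambda>_. card (sumset G B)" "\<lambda>Y. card (sumset G A \<inter> Y)"] fibre
    by (simp add: mult.commute)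
  also have "\<dots> \<le> (\<Sum>Y\<in>rcosets L. card (sumset G A \<inter> Y))"
    using X finR by (intro sum_mono2) auto
  also have "\<dots> = card (sumset G A)"
    using card_eq_sum_cosets[OF assms(1,2) sumset_closed[OF assms(3)]] by simp
  finally show ?thesis .
qed

end

section \<open>Counting over fibres\<close>

lemma sum_nat_ge_subset:
  fixes g :: "'b \<Rightarrow> nat"
  assumes "finite R" "D \<subseteq> R" "\<And>X. X \<in> R \<Longrightarrow> c \<le> g X"
  shows "sum g D + c * (card R - card D) \<le> sum g R"
proof -
  have "c * (card R - card D) \<le> sum g (R - D)"
    using sum_mono[of "R - D" "\<lambda>_. c" g] assms
    by (simp add: card_Diff_subset finite_subset mult.commute)
  then show ?thesis using sum.subset_diff[OF assms(2,1), of g] by simp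
qed

text \<open>The counting argument behind \<open>card_sumset_add_transversal\<close>. Here \<open>R\<close> stands for the set of cosets,
  \<open>f\<close> and \<open>g\<close> for the numbers of points in each coset before and after the new element is adjoined, and
  \<open>\<iota>\<close> for the reflection. The bound \<open>min p (f X + 1) \<le> g X\<close> says that every unfilled coset gains a
  point. The proof distinguishes no, at least two, and exactly one filled coset.\<close>

lemma sum_grown_fibres_ge:
  fixes f g :: "'b \<Rightarrow> nat"
  assumes "finite R" "card R = p" "p \<ge> 5"
    and f: "\<And>X. X \<in> R \<Longrightarrow> 1 \<le> f X" "\<And>X. X \<in> R \<Longrightarrow> f X \<le> p"
    and g: "\<And>X. X \<in> R \<Longrightarrow> min p (f X + 1) \<le> g X"
    and sum_f: "2 * p \<le> sum f R"
    and \<iota>: "\<And>X. X \<in> R \<Longrightarrow> \<iota> X \<in> R" "\<And>X. X \<in> R \<Longrightarrow> \<iota> (\<iota> X) = X"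
      "\<And>X. X \<in> R \<Longrightarrow> f X \<le> f (\<iota> X)"
    and fixed: "\<And>X Y. \<lbrakk>X \<in> R; Y \<in> R; \<iota> X = X; \<iota> Y = Y\<rbrakk> \<Longrightarrow> X = Y"
  shows "3 * p \<le> sum g R"
proof (cases "\<exists>X\<in>R. f X = p")
  case False
  then have "f X + 1 \<le> g X" if "X \<in> R" for X using f(2)[OF that] g[OF that] that by fastforce
  then have "(\<Sum>X\<in>R. f X + 1) \<le> sum g R" by (rule sum_mono)
  moreover have "(\<Sum>X\<in>R. f X + 1) = sum f R + p" using assms(2) by (subst sum.distrib) simp
  ultimately show ?thesis using sum_f by simp
next
  case True
  then obtain X where X: "X \<in> R" "f X = p" by blast
  have g2: "2 \<le> g Y" if "Y \<in> R" for Y using f(1)[OF that] g[OF that] \<open>p \<ge> 5\<close> by linarith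
  have gX: "p \<le> g X" using g X by fastforce
  show ?thesis
  proof (cases "\<exists>Y\<in>R. Y \<noteq> X \<and> f Y = p")
    case True
    then obtain Y where Y: "Y \<in> R" "Y \<noteq> X" "f Y = p" by blast
    have "p \<le> g Y" using g Y by fastforce
    moreover have "sum g {X, Y} + 2 * (card R - card {X, Y}) \<le> sum g R"
      by (rule sum_nat_ge_subset) (use assms(1) X Y g2 in auto)
    ultimately show ?thesis using gX Y(2) assms(2,3) by simp
  next
    case False
    then have unique: "Y = X" if "Y \<in> R" "f Y = p" for Y using that by blast
    \<comment> \<open>The mirror image of the filled coset is filled.\<close>
    have \<iota>X: "\<iota> X = X"
      using unique[of "\<iota> X"] \<iota>[OF X(1)] f(2)[of "\<iota> X"] X(2) by simp
    \<comment> \<open>Otherwise there would be only \<open>p + (p - 1)\<close> points before the growth.\<close>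
    have "\<exists>Y\<in>R. Y \<noteq> X \<and> 2 \<le> f Y"
    proof (rule ccontr)
      assume "\<not> ?thesis"
      then have "sum f (R - {X}) \<le> (\<Sum>Y\<in>R - {X}. 1)" by (intro sum_mono) auto
      moreover have "sum f R = f X + sum f (R - {X})" using assms(1) X(1) by (rule sum.remove)
      moreover have "(\<Sum>Y\<in>R - {X}. 1) = p - 1" using X(1) assms(1,2) by simp
      ultimately show False using sum_f X(2) assms(3) by linarith
    qed
    then obtain Y where Y: "Y \<in> R" "Y \<noteq> X" "2 \<le> f Y" by blast
    have \<iota>Y: "\<iota> Y \<in> R" "\<iota> Y \<noteq> Y" "\<iota> Y \<noteq> X" "2 \<le> f (\<iota> Y)"
      using \<iota>[OF Y(1)] Y \<iota>X fixed[OF X(1) Y(1) \<iota>X] by auto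
    have "3 \<le> g Y" "3 \<le> g (\<iota> Y)"
      using g[OF Y(1)] g[OF \<iota>Y(1)] Y(3) \<iota>Y(4) \<open>p \<ge> 5\<close> by linarith+
    moreover have "sum g {X, Y, \<iota> Y} + 2 * (card R - card {X, Y, \<iota> Y}) \<le> sum g R"
      by (rule sum_nat_ge_subset) (use assms(1) X Y \<iota>Y g2 in auto)
    moreover have "card {X, Y, \<iota> Y} = 3" "sum g {X, Y, \<iota> Y} = g X + g Y + g (\<iota> Y)"
      using Y(2) \<iota>Y(2,3) by auto
    ultimately show ?thesis using gX assms(2,3) by linarith
  qed
qed

section \<open>Elementary abelian groups of rank two\<close>

text \<open>Among the groups of order \<open>p\<^sup>2\<close>, these are the noncyclic ones. The two properties that matter
  are that every nonidentity element spans a line of \<open>p\<close> points and that each line has \<open>p\<close> cosets.\<close>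

locale elementary_rank_two = comm_group G for G (structure) +
  fixes p :: nat
  assumes prime_p: "prime p"
    and order_G: "order G = p\<^sup>2"
    and exponent_p: "x \<in> carrier G \<Longrightarrow> x [^] p = \<one>"
begin

lemma finite_carrier: "finite (carrier G)"
  using order_G prime_gt_0_nat[OF prime_p] by (simp add: order_gt_0_iff_finite[symmetric])

lemma line:
  assumes "a \<in> carrier G" "a \<noteq> \<one>"
  shows "subgroup (generate G {a}) G" "card (generate G {a}) = p" "card (rcosets (generate G {a})) = p"
proof -
  show sub: "subgroup (generate G {a}) G" using assms by (simp add: generate_is_subgroup)
  have "ord a dvd p" using exponent_p assms pow_eq_id by blast
  then have "ord a = p" using prime_p ord_eq_1 assms by (auto simp: prime_nat_iff)
  then show c: "card (generate G {a}) = p" using generate_pow_card assms by simp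
  show "card (rcosets (generate G {a})) = p"
    using lagrange[OF sub] c order_G prime_gt_0_nat[OF prime_p] by (simp add: power2_eq_square)
qed

text \<open>This is the condition \<open>valid\<close>, for an arbitrary group of this kind.\<close>

definition few_on_lines :: "'a multiset \<Rightarrow> bool" where
  "few_on_lines A \<longleftrightarrow> \<one> \<notin># A \<and>
     (\<forall>H. subgroup H G \<and> card H = p \<longrightarrow> size {#x \<in># A. x \<in> H#} < p)"

lemma few_on_lines_subset: "few_on_lines A \<Longrightarrow> B \<subseteq># A \<Longrightarrow> few_on_lines B"
  unfolding few_on_lines_def
  by (metis mset_subset_eqD multiset_filter_mono size_mset_mono order_le_less_trans)

text \<open>The restriction to fewer than \<open>p\<close> points on the line spanned by \<open>a\<close> means that their sumset has
  not been cut off at \<open>p\<close>, so the first factor is \<open>m + 1\<close>.\<close>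

lemma card_sumset_line_cosets:
  assumes "set_mset A \<subseteq> carrier G" "few_on_lines A" "a \<in># A"
  defines "m \<equiv> size {#x \<in># A. x \<in> generate G {a}#}"
  shows "1 \<le> m" "m < p" "(m + 1) * min p (size A - m + 1) \<le> card (sumset G A)"
proof -
  have a: "a \<in> carrier G" "a \<noteq> \<one>" using assms unfolding few_on_lines_def by auto
  have "a \<in># {#x \<in># A. x \<in> generate G {a}#}" using assms(3) by (simp add: generate.incl)
  then show "1 \<le> m" unfolding m_def by (metis One_nat_def Suc_leI nonempty_has_size empty_iff set_mset_empty)
  show mp: "m < p" using assms(2) line[OF a] unfolding few_on_lines_def m_def by blast
  have "\<one> \<notin># A" using assms(2) unfolding few_on_lines_def by blast
  from card_sumset_subgroup_cosets[OF finite_carrier line(1)[OF a] assms(1) _ _ this]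
  show "(m + 1) * min p (size A - m + 1) \<le> card (sumset G A)"
    using line[OF a] prime_p mp unfolding m_def by (simp add: min_absorb2)
qed

theorem card_sumset_size_p:
  assumes "set_mset A \<subseteq> carrier G" "few_on_lines A" "size A = p"
  shows "2 * p \<le> card (sumset G A)"
proof -
  obtain a where a: "a \<in># A" using assms(3) prime_gt_0_nat[OF prime_p] by (metis multiset_nonemptyE nonempty_has_size)
  define m where "m = size {#x \<in># A. x \<in> generate G {a}#}"
  note m = card_sumset_line_cosets[OF assms(1,2) a, folded m_def]
  \<comment> \<open>With \<open>i = m - 1\<close> and \<open>j = p - m - 1\<close> the bound exceeds \<open>2 p\<close> by \<open>i j\<close>.\<close>
  from m(1) obtain i where i: "m = i + 1" by (metis add.commute le_Suc_ex)
  from m(2) obtain j where j: "p = m + (j + 1)" by (metis less_imp_Suc_add Suc_eq_plus1 add_Suc_right)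
  have "2 * p \<le> (i + 2) * (j + 2)" using i j by (simp add: algebra_simps)
  also have "\<dots> = (m + 1) * min p (size A - m + 1)" using assms(3) i j by simp
  finally show ?thesis using m(3) by simp
qed

text \<open>For odd \<open>p\<close>, \<open>z = z\<^bsup>p + 1\<^esup>\<close> is a power of \<open>z\<^sup>2\<close>. This will show that the reflection fixes at most
  one coset.\<close>

lemma sqrt_in_subgroup:
  assumes "p \<noteq> 2" "subgroup L G" "z \<in> carrier G" "z \<otimes> z \<in> L"
  shows "z \<in> L"
proof -
  have "odd p" using assms(1) prime_p by (metis prime_odd_nat prime_ge_2_nat le_neq_implies_less)
  then obtain k where "p = 2 * k + 1" by (elim oddE)
  have "(z \<otimes> z) [^] (k + 1) = (z [^] (2 :: nat)) [^] (k + 1)"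
    using assms(3) by (simp add: numeral_2_eq_2)
  also have "\<dots> = z [^] (p + 1)"
    unfolding nat_pow_pow[OF assms(3)] using \<open>p = 2 * k + 1\<close> by (simp del: nat_pow_Suc)
  also have "\<dots> = z" using assms(3) exponent_p by simp
  finally have "z = (z \<otimes> z) [^] (k + 1)" by simp
  moreover have "(z \<otimes> z) [^] n \<in> L" for n :: nat
    using assms(2,4) by (induction n) (auto simp: subgroup.one_closed subgroup.m_closed)
  ultimately show ?thesis by metis
qed

text \<open>The elements of \<open>B\<close> lie off the line spanned by \<open>a\<close>, and there are enough of them for the sumset
  to meet every coset of that line. Adjoining \<open>a\<close> then adds at least one point to each unfilled
  coset; the reflection settles the case of a single filled coset.\<close>

lemma card_sumset_add_transversal:
  assumes "p \<ge> 5" "a \<in> carrier G" "a \<noteq> \<one>"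
    and "set_mset B \<subseteq> carrier G - generate G {a}" "p \<le> size B + 1" "2 * p \<le> card (sumset G B)"
  shows "3 * p \<le> card (sumset G (add_mset a B))"
proof -
  define L where "L = generate G {a}"
  define R where "R = rcosets L"
  define S where "S = sumset G B"
  define T where "T = sumset G (add_mset a B)"
  have L: "subgroup L G" "card L = p" "card R = p" "L \<subseteq> carrier G"
    using line[OF assms(2,3)] subgroup.subset by (auto simp: L_def R_def)
  have B: "set_mset B \<subseteq> carrier G - L" "set_mset B \<subseteq> carrier G"
    using assms(4) by (auto simp: L_def)
  have S: "S \<subseteq> carrier G" using B sumset_closed by (simp add: S_def)
  have T: "T \<subseteq> carrier G" "T = S \<union> (\<otimes>) a ` S"
    using B assms(2) by (auto simp: T_def S_def sumset_add_mset sumset_closed sumset_closed[THEN subsetD])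
  have finR: "finite R"
    unfolding R_def using finite_carrier L(1) rcosets_part_G finite_UnionD by metis
  have coset: "X \<subseteq> carrier G" "finite X" "card X = p" if "X \<in> R" for X
  proof -
    show "X \<subseteq> carrier G" using that rcosets_part_G[OF L(1)] by (auto simp: R_def)
    then show "finite X" using finite_carrier finite_subset by blast
    show "card X = p" using card_rcosets_equal[of X L] that L by (simp add: R_def)
  qed
  have coset_eq: "L #> x = X" if "X \<in> R" "x \<in> X" for x X
    using that repr_independence[OF _ _ L(1)] L(4) by (auto simp: R_def RCOSETS_def)
  have cosetI: "L #> x \<in> R" "x \<in> L #> x" if "x \<in> carrier G" for x
    using that L by (auto simp: R_def rcosetsI rcos_self)

  \<comment> \<open>\<open>S\<close> meets every coset.\<close>
  have "(#>) L ` S = R"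
  proof (rule card_subset_eq[OF finR])
    show sub: "(#>) L ` S \<subseteq> R" using S cosetI by blast
    have "card R \<le> card ((#>) L ` S)"
      using card_cosets_meeting_sumset[OF L(1) _ B(1)] L(3) prime_p assms(5)
      by (simp add: R_def S_def)
    moreover have "card ((#>) L ` S) \<le> card R" using sub finR by (rule card_mono[rotated])
    ultimately show "card ((#>) L ` S) = card R" by simp
  qed
  then have meets: "\<exists>s. s \<in> S \<inter> X" if "X \<in> R" for X
    using that S cosetI(2) by blast

  have grow: "min p (card (S \<inter> X) + 1) \<le> card (T \<inter> X)" if X: "X \<in> R" for X
  proof (cases "S \<inter> X = X")
    case True
    then have "T \<inter> X = X" using T(2) by blast
    then show ?thesis using coset(3)[OF X] by simp
  next
    case False
    obtain s where s: "s \<in> S \<inter> X" using meets[OF X] by blast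
    have "\<not> generate G {a} #> s \<subseteq> S \<inter> X"
      using coset_eq[OF X, of s] s False by (auto simp: L_def)
    then have "card (S \<inter> X) < card (S \<inter> X \<union> (\<otimes>) a ` (S \<inter> X))"
      using card_less_card_Un_translate[OF finite_carrier _ assms(2) s] S by blast
    also have "\<dots> \<le> card (T \<inter> X)"
    proof (rule card_mono)
      have "a \<otimes> x \<in> X" if "x \<in> X" for x
        using coset_eq[OF X that] generate.incl[of a "{a}" G] by (auto simp: r_coset_def L_def)
      then show "S \<inter> X \<union> (\<otimes>) a ` (S \<inter> X) \<subseteq> T \<inter> X" using T(2) by blast
    qed (use coset(2)[OF X] in simp)
    finally show ?thesis by simp
  qed

  \<comment> \<open>The reflection \<open>x \<mapsto> \<sigma> \<otimes> inv x\<close> preserves \<open>S\<close> and permutes the cosets; \<open>\<iota>\<close> is that permutation.\<close>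
  obtain \<sigma> where \<sigma>: "\<sigma> \<in> carrier G" "\<And>x. x \<in> S \<Longrightarrow> \<sigma> \<otimes> inv x \<in> S"
    using sumset_mirror[OF B(2)] unfolding S_def by metis
  define \<iota> where "\<iota> X = (\<lambda>x. \<sigma> \<otimes> inv x) ` X" for X
  have \<iota>_coset: "\<iota> X \<in> R" if X: "X \<in> R" for X
  proof -
    obtain x where x: "x \<in> carrier G" "X = L #> x" using X by (auto simp: R_def RCOSETS_def)
    have flip: "\<sigma> \<otimes> inv (l \<otimes> x) = inv l \<otimes> (\<sigma> \<otimes> inv x)" if "l \<in> carrier G" for l
      using that x(1) \<sigma>(1) by (simp add: inv_mult m_lcomm)
    have inv_L: "inv l \<in> L" if "l \<in> L" for l using L(1) that by (rule subgroup.m_inv_closed)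
    have "X = (\<lambda>l. l \<otimes> x) ` L" unfolding x(2) r_coset_def by blast
    then have "\<iota> X = (\<lambda>l. \<sigma> \<otimes> inv (l \<otimes> x)) ` L" by (simp add: \<iota>_def image_image)
    also have "\<dots> = (\<lambda>l. inv l \<otimes> (\<sigma> \<otimes> inv x)) ` L"
      by (intro image_cong refl flip) (use L(4) in blast)
    also have "\<dots> = (\<lambda>l. l \<otimes> (\<sigma> \<otimes> inv x)) ` (m_inv G ` L)" by (simp add: image_image)
    also have "m_inv G ` L = L"
    proof (intro equalityI subsetI)
      fix l assume "l \<in> L"
      then have "inv l \<in> L" "l = inv (inv l)" using inv_L L(4) by (blast, metis inv_inv subsetD)
      then show "l \<in> m_inv G ` L" by blast
    qed (use inv_L in blast)
    also have "(\<lambda>l. l \<otimes> (\<sigma> \<otimes> inv x)) ` L = L #> (\<sigma> \<otimes> inv x)" by (auto simp: r_coset_def)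
    finally show ?thesis using cosetI x(1) \<sigma>(1) by simp
  qed
  have flip_flip: "\<sigma> \<otimes> inv (\<sigma> \<otimes> inv x) = x" if "x \<in> carrier G" for x
    using that \<sigma>(1) by (simp add: inv_mult m_assoc[symmetric])
  have \<iota>_inv: "\<iota> (\<iota> X) = X" if X: "X \<in> R" for X
  proof -
    have "\<iota> (\<iota> X) = (\<lambda>x. x) ` X"
      unfolding \<iota>_def image_image by (intro image_cong refl flip_flip subsetD[OF coset(1)[OF X]])
    then show ?thesis by simp
  qed
  have \<iota>_card: "card (S \<inter> X) \<le> card (S \<inter> \<iota> X)" if X: "X \<in> R" for X
  proof (rule card_inj_on_le)
    show "(\<lambda>x. \<sigma> \<otimes> inv x) ` (S \<inter> X) \<subseteq> S \<inter> \<iota> X" using \<sigma>(2) by (auto simp: \<iota>_def)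
    show "inj_on (\<lambda>x. \<sigma> \<otimes> inv x) (S \<inter> X)"
      using S flip_flip by (intro inj_onI) (metis IntD1 subsetD)
    show "finite (S \<inter> \<iota> X)" using coset(2)[OF \<iota>_coset[OF X]] by simp
  qed
  have \<iota>_fixed: "X = Y" if XY: "X \<in> R" "Y \<in> R" "\<iota> X = X" "\<iota> Y = Y" for X Y
  proof -
    obtain x y where x: "x \<in> X" and y: "y \<in> Y" using meets[OF XY(1)] meets[OF XY(2)] by blast
    have G: "x \<in> carrier G" "y \<in> carrier G" using x y coset(1)[OF XY(1)] coset(1)[OF XY(2)] by blast+
    have "\<sigma> \<otimes> inv x \<in> \<iota> X" "\<sigma> \<otimes> inv y \<in> \<iota> Y"
      unfolding \<iota>_def by (rule imageI, fact)+
    then have "\<sigma> \<otimes> inv x \<in> L #> x" "\<sigma> \<otimes> inv y \<in> L #> y"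
      unfolding XY(3,4) coset_eq[OF XY(1) x] coset_eq[OF XY(2) y] by simp_all
    then obtain k l where kl: "k \<in> L" "\<sigma> \<otimes> inv x = k \<otimes> x" "l \<in> L" "\<sigma> \<otimes> inv y = l \<otimes> y"
      by (auto simp: r_coset_def)
    have klG: "k \<in> carrier G" "l \<in> carrier G" using kl L(4) by auto
    \<comment> \<open>\<open>x\<close> and \<open>y\<close> are both square roots of \<open>\<sigma>\<close> modulo \<open>L\<close>, so their quotient \<open>z\<close> has its square in \<open>L\<close>.\<close>
    have "\<sigma> = k \<otimes> x \<otimes> x" "\<sigma> = l \<otimes> y \<otimes> y"
      using kl G klG \<sigma>(1) by (metis inv_solve_right m_closed)+
    then have kl_eq: "k \<otimes> (x \<otimes> x) = l \<otimes> (y \<otimes> y)" using G klG by (simp add: m_assoc)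
    define z where "z = y \<otimes> inv x"
    have z: "z \<in> carrier G" "z \<otimes> x = y" using G by (auto simp: z_def m_assoc)
    have "k \<otimes> (x \<otimes> x) = (l \<otimes> (z \<otimes> z)) \<otimes> (x \<otimes> x)"
      unfolding kl_eq z(2)[symmetric] using z(1) G klG by (simp add: m_ac)
    then have "k = l \<otimes> (z \<otimes> z)" using z(1) G klG by (simp only: right_cancel m_closed)
    then have "z \<otimes> z = inv l \<otimes> k" using z(1) klG by (metis inv_solve_left m_closed)
    then have "z \<otimes> z \<in> L"
      using subgroup.m_closed[OF L(1) subgroup.m_inv_closed[OF L(1) kl(3)] kl(1)] by simp
    then have "z \<in> L" using sqrt_in_subgroup[OF _ L(1) z(1)] assms(1) by simp
    then have "y \<in> L #> x" using z(2) by (auto simp: r_coset_def)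
    then have "y \<in> X" unfolding coset_eq[OF XY(1) x] .
    from coset_eq[OF XY(1) this] coset_eq[OF XY(2) y] show ?thesis by simp
  qed

  have "3 * p \<le> (\<Sum>X\<in>R. card (T \<inter> X))"
  proof (rule sum_grown_fibres_ge[where f = "\<lambda>X. card (S \<inter> X)" and \<iota> = \<iota>])
    show "1 \<le> card (S \<inter> X)" if "X \<in> R" for X
      using meets[OF that] coset(2)[OF that] by (metis One_nat_def Suc_leI card_gt_0_iff empty_iff finite_Int)
    show "card (S \<inter> X) \<le> p" if "X \<in> R" for X
      using coset(2,3)[OF that] by (metis card_mono inf_le2)
    show "2 * p \<le> (\<Sum>X\<in>R. card (S \<inter> X))"
      using assms(6) card_eq_sum_cosets[OF finite_carrier L(1) S] by (simp add: S_def R_def)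
  qed (fact finR L(3) assms(1) grow \<iota>_coset \<iota>_inv \<iota>_card \<iota>_fixed)+
  then show ?thesis
    using card_eq_sum_cosets[OF finite_carrier L(1) T(1)] by (simp add: T_def R_def)
qed

theorem card_sumset_size_Suc_p:
  assumes "p \<ge> 5" "set_mset A \<subseteq> carrier G" "few_on_lines A" "size A = p + 1"
  shows "3 * p \<le> card (sumset G A)"
proof -
  obtain a where a: "a \<in># A" using assms(4) by (metis add_is_0 multiset_nonemptyE size_empty zero_neq_one)
  define m where "m = size {#x \<in># A. x \<in> generate G {a}#}"
  note m = card_sumset_line_cosets[OF assms(2,3) a, folded m_def]
  show ?thesis
  proof (cases "m = 1")
    case False
    with m(1) have "2 \<le> m" by simp
    \<comment> \<open>With \<open>i = m - 2\<close> and \<open>j = p - m - 1\<close> the bound exceeds \<open>3 p\<close> by \<open>i j\<close>.\<close>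
    then obtain i where i: "m = i + 2" by (metis add.commute le_Suc_ex)
    from m(2) obtain j where j: "p = m + (j + 1)" by (metis less_imp_Suc_add Suc_eq_plus1 add_Suc_right)
    have "3 * p \<le> (i + 3) * (j + 3)" using i j by (simp add: algebra_simps)
    also have "\<dots> = (m + 1) * min p (size A - m + 1)"
      using assms(4) i j by (simp add: algebra_simps)
    finally show ?thesis using m(3) by simp
  next
    case True
    define B where "B = A - {#a#}"
    have A: "A = add_mset a B" using a by (simp add: B_def)
    have aG: "a \<in> carrier G" "a \<noteq> \<one>" using assms(2,3) a by (auto simp: few_on_lines_def)
    have "size {#x \<in># B. x \<in> generate G {a}#} = 0"
      using True by (simp add: m_def A generate.incl)
    then have "set_mset B \<subseteq> carrier G - generate G {a}" using assms(2) by (auto simp: A)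
    moreover have "2 * p \<le> card (sumset G B)"
    proof (rule card_sumset_size_p)
      show "few_on_lines B" using assms(3) by (rule few_on_lines_subset) (simp add: A)
    qed (use assms(2,4) in \<open>auto simp: A\<close>)
    ultimately show ?thesis
      using card_sumset_add_transversal[OF assms(1) aG, of B] assms(4) by (simp add: A)
  qed
qed

end

section \<open>The plane over the integers modulo a prime\<close>

lemma elementary_rank_two_Zp2:
  assumes "prime p"
  shows "elementary_rank_two (Zp2 p) p"
proof -
  interpret Z: comm_group "integer_mod_group p" by simp
  have car: "carrier (integer_mod_group p) = {0..<int p}"
    using prime_gt_0_nat[OF assms] by (simp add: carrier_integer_mod_group)
  interpret P: group "Zp2 p" unfolding Zp2_def by (intro DirProd_group) auto
  interpret P: comm_group "Zp2 p"
    by (rule P.group_comm_groupI) (auto simp: Zp2_def add.commute)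
  show ?thesis
  proof
    show "order (Zp2 p) = p\<^sup>2"
      by (simp add: order_def Zp2_def car card_cartesian_product power2_eq_square)
    have pow: "x [^]\<^bsub>Zp2 p\<^esub> n = (fst x [^]\<^bsub>integer_mod_group p\<^esub> n, snd x [^]\<^bsub>integer_mod_group p\<^esub> n)"
      for x and n :: nat
      by (induction n) (simp_all add: Zp2_def mult_DirProd' del: pow_integer_mod_group)
    show "x [^]\<^bsub>Zp2 p\<^esub> p = \<one>\<^bsub>Zp2 p\<^esub>" for x
      by (simp add: pow) (simp add: Zp2_def)
  qed (fact assms)
qed

theorem theorem1p7:
  fixes p :: nat
  assumes "prime p"
  shows "(\<forall>A. set_mset A \<subseteq> carrier (Zp2 p) \<and> valid p A \<and> size A = p
            \<longrightarrow> card (sumset (Zp2 p) A) \<ge> 2 * p) \<and>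
         (p \<ge> 5 \<longrightarrow> (\<forall>A. set_mset A \<subseteq> carrier (Zp2 p) \<and> valid p A \<and> size A = p + 1
            \<longrightarrow> card (sumset (Zp2 p) A) \<ge> 3 * p))"
proof -
  interpret elementary_rank_two "Zp2 p" p using assms by (rule elementary_rank_two_Zp2)
  have "valid p A \<longleftrightarrow> few_on_lines A" for A unfolding valid_def few_on_lines_def ..
  then show ?thesis using card_sumset_size_p card_sumset_size_Suc_p by blast
qed

end
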